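(* In $Q((\lambda))[\log_q\lambda]$ put $$F=\sum_{n=0}^\infty a_n\lambda^n,\qquad H=F\log_q\lambda-F\log_q(1-\lambda)-\sum_{n=1}^\infty a_n\lambda^n\sum_{i=1}^n\left(\frac{2}{[i]_q}+q-1\right),$$ where $a_n=\prod_{i=0}^{n-1}\left(\frac{[i+\frac12]_q}{[i+1]_q}\right)^2$. Then $L[F]=L[H]=0$, where $$L[f]=q\lambda(1-q\lambda)\,d_q^2f+\big(1-(1+[2]_q-2[\tfrac12]_q)\lambda\big)\,d_qf-[\tfrac12]_q^2\,f .$$
   Context: $p$ is an odd prime, $q$ a formal variable, $R=\mathbb{Z}_p[[q-1]]$, $Q=\mathrm{Frac}(R)$. For $a\in\mathbb{Q}\cap\mathbb{Z}_p$, $q^a=\sum_{i\ge0}\binom ai(q-1)^i\in R$ and $[a]_q=\frac{q^a-1}{q-1}\in R$. Let $\gamma$ be the $Q$-algebra automorphism of $Q((\lambda))$ with $\gamma(\sum c_n\lambda^n)=\sum c_nq^n\lambda^n$. Let $\log_q\lambda$ be a formal variable and extend $\gamma$ to the polynomial ring $Q((\lambda))[\log_q\lambda]$ by the ring endomorphism with $\gamma(\log_q\lambda)=q-1+\log_q\lambda$. Define $d_q=\frac{\gamma-1}{(q-1)\lambda}$ on $Q((\lambda))[\log_q\lambda]$ (so $d_q\log_q\lambda=\frac1\lambda$). Finally $\log_q(1-\lambda):=-\sum_{n\ge1}\frac{\lambda^n}{[n]_q}\in Q((\lambda))$. *)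

theory Defs
  imports
    "HOL-Computational_Algebra.Computational_Algebra"
    "HOL-Number_Theory.Number_Theory"
    "Berlekamp_Zassenhaus.Finite_Field"
begin

section \<open>The $p$-adic integers\<close>

text \<open>
  The prime $p$ is the cardinality of the type parameter. \<open>\<int>\<^sub>p\<close> is the inverse limit of the rings
  \<open>\<int>/p\<^sup>n\<int>\<close>; a residue class is represented by its representative in $[0,p^n)$
  (the range is enforced by the compatibility condition).
\<close>

typedef 'p padic_int =
  "{x :: nat \<Rightarrow> int. \<forall>n. x n = x (Suc n) mod int CARD('p::prime_card) ^ n}"
  morphisms padic_nth Abs_padic_int
  by (rule exI[of _ "\<lambda>_. 0"]) simp

setup_lifting type_definition_padic_int

lemma mod_prime_power_Suc:
  fixes a b p :: int
  shows "a mod p ^ Suc n mod p ^ n = a mod p ^ n"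
  by (rule mod_mod_cancel) simp

instantiation padic_int :: (prime_card) comm_ring_1
begin

lift_definition zero_padic_int :: "'a padic_int" is "\<lambda>_. 0" by simp

lift_definition one_padic_int :: "'a padic_int" is "\<lambda>n. 1 mod int CARD('a) ^ n"
  by (simp only: mod_prime_power_Suc simp_thms)

lift_definition plus_padic_int :: "'a padic_int \<Rightarrow> 'a padic_int \<Rightarrow> 'a padic_int"
  is "\<lambda>x y n. (x n + y n) mod int CARD('a) ^ n"
  by (metis mod_add_eq mod_prime_power_Suc)

lift_definition minus_padic_int :: "'a padic_int \<Rightarrow> 'a padic_int \<Rightarrow> 'a padic_int"
  is "\<lambda>x y n. (x n - y n) mod int CARD('a) ^ n"
  by (metis mod_diff_eq mod_prime_power_Suc)

lift_definition uminus_padic_int :: "'a padic_int \<Rightarrow> 'a padic_int"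
  is "\<lambda>x n. (- x n) mod int CARD('a) ^ n"
  by (metis mod_minus_eq mod_prime_power_Suc)

lift_definition times_padic_int :: "'a padic_int \<Rightarrow> 'a padic_int \<Rightarrow> 'a padic_int"
  is "\<lambda>x y n. (x n * y n) mod int CARD('a) ^ n"
  by (metis mod_mult_eq mod_prime_power_Suc)

lemma padic_nth_mod: "padic_nth x n mod int CARD('a) ^ n = padic_nth (x :: 'a padic_int) n"
  by transfer (metis mod_mod_trivial)

lemma padic_eqI: "(\<And>n. padic_nth x n = padic_nth y n) \<Longrightarrow> x = (y :: 'a padic_int)"
  by (simp add: padic_nth_inject[symmetric] fun_eq_iff)

lemmas padic_nth_simps =
  zero_padic_int.rep_eq one_padic_int.rep_eq plus_padic_int.rep_eq minus_padic_int.rep_eq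
  uminus_padic_int.rep_eq times_padic_int.rep_eq

instance
proof
  fix a b c :: "'a padic_int"
  show "a * b * c = a * (b * c)"
    by (rule padic_eqI) (simp only: padic_nth_simps mod_mult_left_eq mod_mult_right_eq mult.assoc)
  show "a * b = b * a"
    by (rule padic_eqI) (simp only: padic_nth_simps mult.commute)
  show "1 * a = a"
    by (rule padic_eqI) (simp only: padic_nth_simps mod_mult_left_eq mult_1_left padic_nth_mod)
  show "a + b + c = a + (b + c)"
    by (rule padic_eqI) (simp only: padic_nth_simps mod_add_left_eq mod_add_right_eq add.assoc)
  show "a + b = b + a"
    by (rule padic_eqI) (simp only: padic_nth_simps add.commute)
  show "0 + a = a"
    by (rule padic_eqI) (simp only: padic_nth_simps add_0_left padic_nth_mod)
  show "- a + a = 0"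
    by (rule padic_eqI) (simp only: padic_nth_simps mod_add_left_eq left_minus mod_0)
  show "a - b = a + - b"
    by (rule padic_eqI) (simp only: padic_nth_simps mod_add_right_eq diff_conv_add_uminus)
  show "(a + b) * c = a * c + b * c"
    by (rule padic_eqI) (simp only: padic_nth_simps mod_mult_left_eq mod_add_eq distrib_right)
  show "(0 :: 'a padic_int) \<noteq> 1"
  proof
    assume "(0 :: 'a padic_int) = 1"
    hence "padic_nth (0 :: 'a padic_int) 1 = padic_nth 1 1" by simp
    thus False
      using prime_gt_1_nat[OF prime_card[where 'a = 'a]]
      by (simp add: zero_padic_int.rep_eq one_padic_int.rep_eq)
  qed
qed

end

lemma padic_nth_le:
  assumes "m \<le> n"
  shows "padic_nth x n mod int CARD('p) ^ m = padic_nth (x :: 'p::prime_card padic_int) m"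
  using assms
proof (induction n rule: dec_induct)
  case base
  show ?case by (rule padic_nth_mod)
next
  case (step n)
  have "padic_nth x n = padic_nth x (Suc n) mod int CARD('p) ^ n"
    using padic_nth[of x] by blast
  moreover have "int CARD('p) ^ m dvd int CARD('p) ^ n"
    using step.hyps by (simp add: le_imp_power_dvd)
  ultimately show ?case
    using step.IH by (metis mod_mod_cancel)
qed

instance padic_int :: (prime_card) idom
proof
  fix a b :: "'a padic_int"
  assume ab: "a \<noteq> 0" "b \<noteq> 0"
  let ?p = "int CARD('a)"
  from ab obtain m n where mn: "padic_nth a m \<noteq> 0" "padic_nth b n \<noteq> 0"
    by (metis padic_nth_inject zero_padic_int.rep_eq ext)
  let ?x = "padic_nth a (m + n)" and ?y = "padic_nth b (m + n)"
  have p: "prime ?p" using prime_card by simp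
  have nd: "\<not> ?p ^ m dvd ?x" "\<not> ?p ^ n dvd ?y"
    using mn padic_nth_le[of m "m + n" a] padic_nth_le[of n "m + n" b]
    by (auto simp: dvd_eq_mod_eq_0)
  hence nz: "?x \<noteq> 0" "?y \<noteq> 0" by auto
  have "multiplicity ?p ?x < m" "multiplicity ?p ?y < n"
    using nd by (auto simp: not_le[symmetric] intro: multiplicity_dvd')
  moreover have "multiplicity ?p (?x * ?y) = multiplicity ?p ?x + multiplicity ?p ?y"
    using p nz by (intro prime_elem_multiplicity_mult_distrib) auto
  ultimately have "multiplicity ?p (?x * ?y) < m + n" by simp
  hence "\<not> ?p ^ (m + n) dvd ?x * ?y"
    using nz prime_gt_1_nat[OF prime_card[where 'a = 'a]] multiplicity_geI[of "?x * ?y" ?p "m + n"]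
    by (auto simp: not_less[symmetric])
  hence "padic_nth (a * b) (m + n) \<noteq> 0"
    by (simp add: times_padic_int.rep_eq dvd_eq_mod_eq_0)
  thus "a * b \<noteq> 0" by (auto simp: zero_padic_int.rep_eq)
qed

lemma padic_nth_of_nat:
  "padic_nth (of_nat k :: 'p::prime_card padic_int) n = int k mod int CARD('p) ^ n"
  by (induction k)
     (simp_all add: zero_padic_int.rep_eq one_padic_int.rep_eq plus_padic_int.rep_eq mod_simps)

lemma padic_nth_of_int:
  "padic_nth (of_int k :: 'p::prime_card padic_int) n = k mod int CARD('p) ^ n"
  by (cases k rule: int_cases2)
     (simp_all add: padic_nth_of_nat uminus_padic_int.rep_eq mod_simps)

lemma of_int_padic_eq_0_iff: "(of_int k :: 'p::prime_card padic_int) = 0 \<longleftrightarrow> k = 0"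
proof
  assume *: "(of_int k :: 'p padic_int) = 0"
  have "k mod int CARD('p) ^ n = 0" for n
    using arg_cong[OF *, of "\<lambda>x. padic_nth x n"]
    by (simp add: padic_nth_of_int zero_padic_int.rep_eq)
  hence dvd: "int CARD('p) ^ n dvd k" for n by (simp add: dvd_eq_mod_eq_0)
  show "k = 0"
  proof (rule ccontr)
    assume "k \<noteq> 0"
    moreover have "\<not> is_unit (int CARD('p))"
      using prime_gt_1_nat[OF prime_card[where 'a = 'p]] by simp
    ultimately have "multiplicity (int CARD('p)) k \<ge> n" for n
      using dvd by (intro multiplicity_geI) auto
    from this[of "Suc (multiplicity (int CARD('p)) k)"] show False by simp
  qed
qed simp

instance padic_int :: (prime_card) ring_char_0
proof
  show "inj (of_nat :: nat \<Rightarrow> 'a padic_int)"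
  proof (rule injI)
    fix m n :: nat
    assume "(of_nat m :: 'a padic_int) = of_nat n"
    hence "(of_int (int m - int n) :: 'a padic_int) = 0" by simp
    thus "m = n" by (simp only: of_int_padic_eq_0_iff)
  qed
qed

text \<open>
  The inclusion of \<open>\<rat> \<inter> \<int>\<^sub>p\<close> into \<open>\<int>\<^sub>p\<close>, unspecified on rationals that are not $p$-integral.
\<close>

definition padic_of_rat :: "rat \<Rightarrow> 'p::prime_card padic_int" where
  "padic_of_rat r =
     (THE x. of_int (snd (quotient_of r)) * x = of_int (fst (quotient_of r)))"

lemma padic_of_rat_eqI:
  assumes "of_int (snd (quotient_of r)) * x = (of_int (fst (quotient_of r)) :: 'p::prime_card padic_int)"
  shows "padic_of_rat r = x"
proof -
  have "(of_int (snd (quotient_of r)) :: 'p padic_int) \<noteq> 0"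
    using quotient_of_denom_pos'[of r] by (simp add: of_int_padic_eq_0_iff)
  thus ?thesis
    unfolding padic_of_rat_def using assms
    by (intro the_equality) (auto simp flip: assms)
qed

lemma padic_of_rat_of_int [simp]: "padic_of_rat (of_int k) = (of_int k :: 'p::prime_card padic_int)"
  by (rule padic_of_rat_eqI) simp

lemma padic_of_rat_correct:
  assumes "coprime (snd (quotient_of r)) (int CARD('p))"
  shows "of_int (snd (quotient_of r)) * padic_of_rat r =
           (of_int (fst (quotient_of r)) :: 'p::prime_card padic_int)"
proof -
  let ?p = "int CARD('p)" and ?a = "fst (quotient_of r)" and ?b = "snd (quotient_of r)"
  have "\<exists>c. [?b * c = ?a] (mod ?p ^ n)" for n
  proof -
    from assms have "coprime ?b (?p ^ n)" by simp
    then obtain d where "[?b * d = 1] (mod ?p ^ n)" using cong_solve_coprime_int by blast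
    hence "[?b * d * ?a = 1 * ?a] (mod ?p ^ n)" by (rule cong_scalar_right)
    thus ?thesis by (intro exI[of _ "d * ?a"]) (simp add: mult.assoc)
  qed
  then obtain c where c: "[?b * c n = ?a] (mod ?p ^ n)" for n by metis
  have "c n mod ?p ^ n = (c (Suc n) mod ?p ^ Suc n) mod ?p ^ n" for n
  proof -
    have "[?b * c (Suc n) = ?a] (mod ?p ^ n)"
      using c[of "Suc n"] by (rule cong_dvd_modulus) simp
    hence "[?b * c n = ?b * c (Suc n)] (mod ?p ^ n)"
      using c[of n] by (metis cong_sym cong_trans)
    hence "[c n = c (Suc n)] (mod ?p ^ n)"
      using assms by (subst (asm) cong_mult_lcancel) auto
    thus ?thesis unfolding mod_prime_power_Suc by (simp add: cong_def)
  qed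
  note compat = this
  have nth: "padic_nth (Abs_padic_int (\<lambda>n. c n mod ?p ^ n) :: 'p padic_int) n = c n mod ?p ^ n" for n
    by (subst Abs_padic_int_inverse, intro CollectI allI compat) (rule refl)
  have eq: "of_int ?b * (Abs_padic_int (\<lambda>n. c n mod ?p ^ n)) = (of_int ?a :: 'p padic_int)"
  proof (subst padic_nth_inject[symmetric], rule ext)
    fix n
    show "padic_nth (of_int ?b * (Abs_padic_int (\<lambda>n. c n mod ?p ^ n)) :: 'p padic_int) n =
            padic_nth (of_int ?a :: 'p padic_int) n"
      using c[of n] by (simp add: times_padic_int.rep_eq padic_nth_of_int nth mod_simps cong_def)
  qed
  show ?thesis
    using padic_of_rat_eqI[OF eq] eq by simp
qed

section \<open>$q$-numbers\<close>

text \<open>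
  $R = \mathbf{Z}_p[[q-1]]$ is the power series ring over \<open>\<int>\<^sub>p\<close> in the variable $q-1$,
  i.e. \<open>fps_X\<close> is $q-1$.
\<close>

type_synonym 'p qring = "'p padic_int fps"
type_synonym 'p qfrac = "'p qring fract"

abbreviation to_qfrac :: "'p::prime_card qring \<Rightarrow> 'p qfrac" where
  "to_qfrac x \<equiv> Fraction_Field.Fract x 1"

definition qvar :: "'p::prime_card qfrac" where
  "qvar = to_qfrac (1 + fps_X)"

text \<open>Only meaningful for $a \in \mathbf{Q}\cap\mathbf{Z}_p$.\<close>

definition q_pow :: "rat \<Rightarrow> 'p::prime_card qring" where
  "q_pow a = Abs_fps (\<lambda>i. padic_of_rat (a gchoose i))"

definition q_num :: "rat \<Rightarrow> 'p::prime_card qfrac" where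
  "q_num a = (to_qfrac (q_pow a) - 1) / (qvar - 1)"

lemma q_pow_of_nat: "q_pow (of_nat n) = ((1 + fps_X) ^ n :: 'p::prime_card qring)"
proof (rule fps_ext)
  fix i
  have "padic_of_rat (of_nat n gchoose i) = (of_nat (n choose i) :: 'p padic_int)"
    using padic_of_rat_of_int[of "int (n choose i)", where 'p = 'p]
    by (simp add: binomial_gbinomial)
  moreover have "((1 + fps_X) ^ n :: 'p qring) = (\<Sum>k\<le>n. of_nat (n choose k) * fps_X ^ k)"
    by (subst add.commute, subst binomial_ring) simp
  hence "((1 + fps_X) ^ n :: 'p qring) $ i = of_nat (n choose i)"
    by (auto simp: fps_sum_nth fps_mult_of_nat_nth fps_X_power_nth if_distrib
             intro!: binomial_eq_0 cong: if_cong)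
  ultimately show "q_pow (of_nat n) $ i = ((1 + fps_X) ^ n :: 'p qring) $ i"
    by (simp add: q_pow_def)
qed

lemma qvar_neq_0: "qvar \<noteq> (0 :: 'p::prime_card qfrac)"
proof -
  have "(1 + fps_X :: 'p qring) $ 0 \<noteq> 0 $ 0" by simp
  hence "(1 + fps_X :: 'p qring) \<noteq> 0" by metis
  thus ?thesis by (simp add: qvar_def Fraction_Field.Zero_fract_def eq_fract)
qed

lemma qvar_minus_1: "qvar - 1 = (to_qfrac fps_X :: 'p::prime_card qfrac)"
  by (simp add: qvar_def Fraction_Field.One_fract_def)

lemma qvar_neq_1: "qvar \<noteq> (1 :: 'p::prime_card qfrac)"
proof -
  have "qvar - 1 \<noteq> (0 :: 'p qfrac)"
    unfolding qvar_minus_1 by (simp add: Fraction_Field.Zero_fract_def eq_fract)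
  thus ?thesis by simp
qed

section \<open>The $q$-difference operator on $Q((\lambda))[\log_q\lambda]$\<close>

text \<open>
  Elements of $Q((\lambda))[\log_q\lambda]$ are polynomials over the Laurent series ring;
  \<open>fls_X\<close> is $\lambda$ and the polynomial variable is $\log_q\lambda$.
\<close>

type_synonym 'p qlog = "'p qfrac fls poly"

lift_definition gamma_fls :: "'p::prime_card qfrac fls \<Rightarrow> 'p qfrac fls"
  is "\<lambda>c n. c n * qvar powi n"
  by (erule eventually_mono) simp

definition gamma :: "'p::prime_card qlog \<Rightarrow> 'p qlog" where
  "gamma f = pcompose (map_poly gamma_fls f) [: fls_const (qvar - 1), 1 :]"

definition d_q :: "'p::prime_card qlog \<Rightarrow> 'p qlog" where
  "d_q f = [: inverse (fls_const (qvar - 1) * fls_X) :] * (gamma f - f)"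

definition log_lambda :: "'p::prime_card qlog" where
  "log_lambda = [: 0, 1 :]"

lemma gamma_log_lambda: "gamma log_lambda = [: fls_const (qvar - 1) :] + (log_lambda :: 'p::prime_card qlog)"
proof -
  have "gamma_fls 0 = (0 :: 'p qfrac fls)" by transfer simp
  moreover have "gamma_fls 1 = (1 :: 'p qfrac fls)"
    by (rule fls_eqI) (simp add: gamma_fls.rep_eq)
  ultimately show ?thesis
    by (simp add: gamma_def log_lambda_def map_poly_pCons pcompose_pCons)
qed

lemma d_q_log_lambda: "d_q log_lambda = [: inverse (fls_X :: 'p::prime_card qfrac fls) :]"
proof -
  have "fls_const (qvar - 1) \<noteq> (0 :: 'p qfrac fls)"
    using qvar_neq_1 by (simp add: fls_const_nonzero)
  thus ?thesis
    by (simp add: d_q_def gamma_log_lambda)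
qed

definition log_one_minus_lambda :: "'p::prime_card qfrac fls" where
  "log_one_minus_lambda = - fps_to_fls (Abs_fps (\<lambda>n. if n = 0 then 0 else 1 / q_num (of_nat n)))"

section \<open>The $q$-hypergeometric equation\<close>

definition hyp_coeff :: "nat \<Rightarrow> 'p::prime_card qfrac" where
  "hyp_coeff n = (\<Prod>i<n. (q_num (of_nat i + 1 / 2) / q_num (of_nat i + 1))\<^sup>2)"

definition F_series :: "'p::prime_card qfrac fls" where
  "F_series = fps_to_fls (Abs_fps hyp_coeff)"

definition F_sol :: "'p::prime_card qlog" where
  "F_sol = [: F_series :]"

definition H_sol :: "'p::prime_card qlog" where
  "H_sol = [: F_series :] * log_lambda - [: F_series * log_one_minus_lambda :]
     - [: fps_to_fls (Abs_fps (\<lambda>n. if n = 0 then 0 else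
            hyp_coeff n * (\<Sum>i=1..n. (2 / q_num (of_nat i) + qvar - 1)))) :]"

definition hyp_L :: "'p::prime_card qlog \<Rightarrow> 'p qlog" where
  "hyp_L f =
     [: fls_const qvar * fls_X * (1 - fls_const qvar * fls_X) :] * d_q (d_q f)
     + [: 1 - fls_const (1 + q_num 2 - 2 * q_num (1 / 2)) * fls_X :] * d_q f
     - [: fls_const ((q_num (1 / 2))\<^sup>2) :] * f"

end

theory Submission
  imports Defs
begin

text \<open>
  On a power series $f = \sum c_n \lambda^n$ the operator $L$ acts by
  \[ L[f]_n = [n+1]_q^2\, c_{n+1} - [n+\tfrac12]_q^2\, c_n . \]
  This rests on $[n+\frac12]_q = [\frac12]_q + q^{1/2}[n]_q$ and on the quadratic relation
  $(q-1)[\frac12]_q^2 = 1 - 2[\frac12]_q$, which both come from $q^a q^b = q^{a+b}$ for $p$-integral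
  $a$, $b$ (\<open>q_pow_add\<close>); the number $\frac12$ is $p$-integral because $p$ is odd. As the ratio of
  consecutive $a_n$ is the square of $[n+\frac12]_q/[n+1]_q$, it follows that $L[F] = 0$.

  For the second solution, let $\ell = \log_q\lambda$ and let $S_n$ be the inner sum in $H$. The
  twisted Leibniz rule $d_q(fg) = d_q f\cdot g + \gamma f\cdot d_q g$ gives
  \[ L[fg] = L[f]\,g + T(f, d_q g), \]
  where the cross term $T(f,v)$ is additive in $v$ and only sees the derivative of $g$
  (\<open>hyp_L_fls_mult\<close>). The same formula holds with $g = \ell$ and $d_q\ell = 1/\lambda$
  (\<open>hyp_L_linear\<close>). Since $d_q\log_q(1-\lambda) = -1/(1-\lambda)$ and $L[F] = 0$,
  the two logarithmic terms of $H$ together contribute $T(F,u)$ with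
  \[ u = \frac1\lambda + \frac1{1-\lambda} = \frac1{\lambda(1-\lambda)}, \]
  a function free of logarithms. It remains to see that $T(F,u)$ equals $L$ of the
  last sum in $H$. By the recurrence for $a_n$, the coefficient of $L[\sum a_n S_n\lambda^n]$ at
  $\lambda^n$ is $[n+1]_q^2 a_{n+1}(S_{n+1}-S_n) = (1+q^{n+1})[n+1]_q a_{n+1}$, so
  $L[\sum a_n S_n\lambda^n] = d_qF + q\gamma d_qF$ (\<open>hyp_L_fls_harmonic_correction\<close>). On the other
  hand $(1-\lambda)T(F,u)$ is an explicit combination of $\gamma F$ and $\gamma d_q F$
  (\<open>hyp_cross_term_explicit\<close>), and a relation of first order in $d_q$
  (\<open>F_series_first_order\<close>), equivalent to the recurrence for $a_n$, identifies the two.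
\<close>

unbundle Formal_Laurent_Series.fps_syntax

section \<open>Powers of $q$ with $p$-integral exponents\<close>

text \<open>
  The fraction need not be in lowest terms; this makes closure under sums and products immediate.
\<close>

definition p_integral :: "nat \<Rightarrow> rat \<Rightarrow> bool" where
  "p_integral p r \<longleftrightarrow> (\<exists>c d. \<not> int p dvd d \<and> r = of_int c / of_int d)"

lemma p_integral_of_int: "prime p \<Longrightarrow> p_integral p (of_int c)"
  unfolding p_integral_def by (rule exI[of _ c], rule exI[of _ 1]) (auto simp: prime_gt_Suc_0_nat)

lemma p_integral_add:
  assumes "prime p" "p_integral p r" "p_integral p s"
  shows "p_integral p (r + s)"
proof -
  from assms obtain a b c d where *: "\<not> int p dvd b" "r = of_int a / of_int b"
    "\<not> int p dvd d" "s = of_int c / of_int d"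
    unfolding p_integral_def by blast
  hence "b \<noteq> 0" "d \<noteq> 0" by auto
  hence "r + s = of_int (a * d + c * b) / of_int (b * d)"
    using * by (simp add: add_frac_eq)
  moreover have "\<not> int p dvd b * d" using * assms(1) by (simp add: prime_dvd_mult_iff)
  ultimately show ?thesis unfolding p_integral_def by blast
qed

lemma p_integral_mult:
  assumes "prime p" "p_integral p r" "p_integral p s"
  shows "p_integral p (r * s)"
proof -
  from assms obtain a b c d where *: "\<not> int p dvd b" "r = of_int a / of_int b"
    "\<not> int p dvd d" "s = of_int c / of_int d"
    unfolding p_integral_def by blast
  have "r * s = of_int (a * c) / of_int (b * d)" using * by simp
  moreover have "\<not> int p dvd b * d" using * assms(1) by (simp add: prime_dvd_mult_iff)
  ultimately show ?thesis unfolding p_integral_def by blast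
qed

text \<open>
  Write $a = c/b$ and let $p^N$ be the exact power of $p$ in $k!$. Modulo $p^N$ the number $a$ is
  congruent to a natural number $m$, so that $\prod_{i<k}(c - ib) \equiv b^k\, k! \binom mk \equiv 0$.
  Hence the numerator of $\binom ak$ cancels all factors $p$ of $k!$.
\<close>

lemma p_integral_gchoose:
  assumes p: "prime p" and a: "p_integral p a"
  shows "p_integral p (a gchoose k)"
proof -
  from a obtain c b where b: "\<not> int p dvd b" and a_eq: "a = of_int c / of_int b"
    unfolding p_integral_def by blast
  define N where "N = multiplicity p (fact k :: nat)"
  have "\<not> is_unit p" using p by auto
  then obtain w where w: "(fact k :: nat) = p ^ N * w" "\<not> p dvd w"
    unfolding N_def by (metis fact_nonzero multiplicity_decompose')
  have "coprime b (int p ^ N)"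
    using b p by (metis coprime_commute coprime_power_right_iff prime_imp_coprime prime_nat_int_transfer)
  then obtain e where "[b * e = 1] (mod int p ^ N)" using cong_solve_coprime_int by blast
  hence e: "[b * (e * c) = c] (mod int p ^ N)"
    using cong_scalar_right[of "b * e" 1 "int p ^ N" c] by (simp add: mult.assoc)
  define m where "m = nat ((e * c) mod int p ^ N)"
  have "int m = (e * c) mod int p ^ N" using p by (simp add: m_def prime_gt_0_nat)
  hence "[int m = e * c] (mod int p ^ N)" by (simp add: cong_def)
  hence bm: "[c = b * int m] (mod int p ^ N)"
    using e by (metis cong_scalar_left cong_sym cong_trans)
  define P where "P = (\<Prod>i = 0..<k. c - int i * b)"
  have "[P = (\<Prod>i = 0..<k. b * int m - int i * b)] (mod int p ^ N)"
    unfolding P_def by (intro cong_prod cong_diff bm cong_refl)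
  also have "(\<Prod>i = 0..<k. b * int m - int i * b) = b ^ k * (\<Prod>i = 0..<k. int m - int i)"
  proof -
    have "b * int m - int i * b = b * (int m - int i)" for i by (simp add: algebra_simps)
    thus ?thesis by (simp add: prod.distrib)
  qed
  also have "(\<Prod>i = 0..<k. int m - int i) = fact k * int (m choose k)"
  proof -
    have "(of_int (\<Prod>i = 0..<k. int m - int i) :: rat) = fact k * (of_nat m gchoose k)"
      by (simp add: gbinomial_mult_fact)
    also have "\<dots> = of_int (fact k * int (m choose k))" by (simp add: binomial_gbinomial)
    finally show ?thesis by (simp only: of_int_eq_iff)
  qed
  also have "fact k = int p ^ N * int w"
    by (metis w(1) of_nat_fact of_nat_mult of_nat_power)
  finally have "int p ^ N dvd P" by (simp add: cong_dvd_iff)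
  then obtain u where u: "P = int p ^ N * u" by blast
  have nz: "b \<noteq> 0" "p \<noteq> 0" using b p by auto
  have "w \<noteq> 0" using w(2) by (metis dvd_0_right)
  note nz = nz this
  have "(\<Prod>i = 0..<k. a - of_nat i) * of_int b ^ k = (\<Prod>i = 0..<k. (a - of_nat i) * of_int b)"
    by (simp add: prod.distrib)
  also have "\<dots> = of_int P"
    unfolding P_def a_eq using nz by (simp add: algebra_simps)
  finally have "(a gchoose k) * fact k * of_int b ^ k = of_int P"
    by (simp add: gbinomial_mult_fact')
  also have "fact k = (of_nat p ^ N * of_nat w :: rat)"
    by (metis w(1) of_nat_fact of_nat_mult of_nat_power)
  finally have "(a gchoose k) = of_int u / of_int (int w * b ^ k)"
    using nz unfolding u by (simp add: field_simps)
  moreover have "\<not> int p dvd b ^ k"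
    using b p prime_dvd_power[of "int p" b k] by auto
  hence "\<not> int p dvd int w * b ^ k"
    using w(2) p by (simp add: prime_dvd_mult_iff)
  ultimately show ?thesis unfolding p_integral_def by blast
qed

text \<open>
  Frees the characterisation of the inclusion of $p$-integral rationals from lowest terms, so that sums
  and products of fractions can be computed with any denominators prime to $p$.
\<close>

lemma padic_of_rat_divide:
  fixes c d :: int
  assumes "\<not> int CARD('p::prime_card) dvd d"
  shows "of_int d * padic_of_rat (of_int c / of_int d) = (of_int c :: 'p padic_int)"
proof -
  define r where "r = (of_int c / of_int d :: rat)"
  obtain a b where ab: "quotient_of r = (a, b)" by (cases "quotient_of r")
  have r_eq: "r = of_int a / of_int b" and b: "b > 0" and cop: "coprime a b"
    using quotient_of_div[OF ab] quotient_of_denom_pos[OF ab] quotient_of_coprime[OF ab] by auto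
  have d: "d \<noteq> 0" using assms by auto
  have "(of_int (c * b) :: rat) = of_int (a * d)"
    using r_eq b d by (simp add: r_def field_simps)
  hence cb: "c * b = a * d" by (simp only: of_int_eq_iff)
  hence "b dvd d * a" by (metis dvd_triv_right mult.commute)
  hence "b dvd d" using cop by (simp add: coprime_commute coprime_dvd_mult_left_iff)
  hence "\<not> int CARD('p) dvd b" using assms dvd_trans by blast
  hence "coprime b (int CARD('p))"
    by (metis coprime_commute prime_card prime_imp_coprime prime_nat_int_transfer)
  hence "of_int b * padic_of_rat r = (of_int a :: 'p padic_int)"
    using padic_of_rat_correct[of r, where 'p = 'p] ab by simp
  hence "of_int b * (of_int d * padic_of_rat r) = of_int b * (of_int c :: 'p padic_int)"
    by (metis cb mult.commute mult.left_commute of_int_mult)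
  thus ?thesis using b of_int_padic_eq_0_iff[of b, where 'p = 'p] unfolding r_def[symmetric] by simp
qed

lemma padic_of_rat_eq_divideI:
  fixes c d :: int and x :: "'p::prime_card padic_int"
  assumes "\<not> int CARD('p) dvd d" "of_int d * x = of_int c"
  shows "padic_of_rat (of_int c / of_int d) = x"
proof -
  have "(of_int d :: 'p padic_int) \<noteq> 0"
    using assms(1) by (auto simp: of_int_padic_eq_0_iff)
  moreover have "of_int d * padic_of_rat (of_int c / of_int d) = of_int d * x"
    using padic_of_rat_divide[OF assms(1)] assms(2) by simp
  ultimately show ?thesis by simp
qed

lemma padic_of_rat_add:
  assumes "p_integral CARD('p::prime_card) r" "p_integral CARD('p) s"
  shows "padic_of_rat (r + s) = (padic_of_rat r + padic_of_rat s :: 'p padic_int)"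
proof -
  from assms obtain a b c d where *: "\<not> int CARD('p) dvd b" "r = of_int a / of_int b"
    "\<not> int CARD('p) dvd d" "s = of_int c / of_int d"
    unfolding p_integral_def by blast
  hence "b \<noteq> 0" "d \<noteq> 0" by auto
  hence eq: "r + s = of_int (a * d + c * b) / of_int (b * d)"
    using * by (simp add: add_frac_eq)
  have nd: "\<not> int CARD('p) dvd b * d"
    using * prime_card[where 'a = 'p] by (simp add: prime_dvd_mult_iff)
  have "of_int b * padic_of_rat r = (of_int a :: 'p padic_int)"
       "of_int d * padic_of_rat s = (of_int c :: 'p padic_int)"
    using * padic_of_rat_divide by auto
  moreover have "of_int (b * d) * (padic_of_rat r + padic_of_rat s :: 'p padic_int)
      = of_int b * padic_of_rat r * of_int d + of_int d * padic_of_rat s * of_int b"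
    by (simp add: algebra_simps)
  ultimately have "of_int (b * d) * (padic_of_rat r + padic_of_rat s) = (of_int (a * d + c * b) :: 'p padic_int)"
    by simp
  from padic_of_rat_eq_divideI[OF nd this] show ?thesis unfolding eq .
qed

lemma padic_of_rat_mult:
  assumes "p_integral CARD('p::prime_card) r" "p_integral CARD('p) s"
  shows "padic_of_rat (r * s) = (padic_of_rat r * padic_of_rat s :: 'p padic_int)"
proof -
  from assms obtain a b c d where *: "\<not> int CARD('p) dvd b" "r = of_int a / of_int b"
    "\<not> int CARD('p) dvd d" "s = of_int c / of_int d"
    unfolding p_integral_def by blast
  hence eq: "r * s = of_int (a * c) / of_int (b * d)" by simp
  have nd: "\<not> int CARD('p) dvd b * d"
    using * prime_card[where 'a = 'p] by (simp add: prime_dvd_mult_iff)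
  have "of_int b * padic_of_rat r = (of_int a :: 'p padic_int)"
       "of_int d * padic_of_rat s = (of_int c :: 'p padic_int)"
    using * padic_of_rat_divide by auto
  moreover have "of_int (b * d) * (padic_of_rat r * padic_of_rat s :: 'p padic_int)
      = (of_int b * padic_of_rat r) * (of_int d * padic_of_rat s)"
    by (simp add: algebra_simps)
  ultimately have "of_int (b * d) * (padic_of_rat r * padic_of_rat s) = (of_int (a * c) :: 'p padic_int)"
    by simp
  from padic_of_rat_eq_divideI[OF nd this] show ?thesis unfolding eq .
qed

text \<open>
  Integrality of the sum is part of the conclusion because the induction needs it in each step.
\<close>

lemma padic_of_rat_sum:
  assumes "\<And>i. i \<in> A \<Longrightarrow> p_integral CARD('p::prime_card) (f i)"
  shows "padic_of_rat (\<Sum>i\<in>A. f i) = (\<Sum>i\<in>A. padic_of_rat (f i) :: 'p padic_int)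
           \<and> p_integral CARD('p) (\<Sum>i\<in>A. f i)"
  using assms
proof (induction A rule: infinite_finite_induct)
  case (insert x A)
  thus ?case by (simp add: padic_of_rat_add p_integral_add prime_card)
qed (use padic_of_rat_of_int[of 0, where 'p = 'p] p_integral_of_int[of "CARD('p)" 0] prime_card[where 'a = 'p] in auto)

text \<open>
  Coefficientwise this is Vandermonde's identity in $\mathbf{Q}$; integrality of the binomial
  coefficients lets it be transported to $\mathbf{Z}_p$.
\<close>

lemma q_pow_add:
  assumes "p_integral CARD('p::prime_card) a" "p_integral CARD('p) b"
  shows "q_pow (a + b) = (q_pow a * q_pow b :: 'p qring)"
proof (rule fps_ext)
  fix n
  have int: "p_integral CARD('p) (a gchoose i)" "p_integral CARD('p) (b gchoose i)" for i
    using assms by (auto intro: p_integral_gchoose prime_card)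
  have "q_pow (a + b) $ n = (padic_of_rat (\<Sum>i=0..n. (a gchoose i) * (b gchoose (n - i))) :: 'p padic_int)"
    by (simp add: q_pow_def gbinomial_Vandermonde)
  also have "\<dots> = (\<Sum>i=0..n. padic_of_rat (a gchoose i) * padic_of_rat (b gchoose (n - i)))"
    using int by (simp add: padic_of_rat_sum padic_of_rat_mult p_integral_mult prime_card)
  also have "\<dots> = (q_pow a * q_pow b) $ n" by (simp add: fps_mult_nth q_pow_def)
  finally show "q_pow (a + b) $ n = (q_pow a * q_pow b :: 'p qring) $ n" .
qed

lemma p_integral_half:
  assumes "prime p" "odd p"
  shows "p_integral p (1 / 2)"
proof -
  have "\<not> int p dvd 2"
  proof
    assume "int p dvd 2"
    hence "p dvd 2" by presburger
    thus False using assms by (metis primes_dvd_imp_eq two_is_prime_nat)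
  qed
  thus ?thesis unfolding p_integral_def by (intro exI[of _ 1] exI[of _ 2]) simp
qed

section \<open>Polynomial identities\<close>

text \<open>
  The eliminations behind the main computation, with $Q$ for $q$, $h$ for $[\frac12]_q$, $K$, $N$, $M$
  for consecutive $q$-numbers and $x$ for $\lambda$. The qualified name selects Groebner bases over
  type-class rings; unqualified, it denotes the normalisation method for rings with carrier sets.
\<close>

lemma half_quadratic_identity:
  fixes Q h :: "'a :: idom"
  assumes "(1 + (Q - 1) * h)\<^sup>2 = Q"
  shows "(Q - 1) * ((Q - 1) * h\<^sup>2) = (Q - 1) * (1 - 2 * h)"
proof -
  have "(1 + (Q - 1) * h)\<^sup>2 = 1 + (Q - 1) * (2 * h) + (Q - 1) * ((Q - 1) * h\<^sup>2)"
    by (simp add: power2_eq_square algebra_simps)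
  thus ?thesis using assms by (simp add: algebra_simps)
qed

lemma half_shift_identity:
  fixes Q h N :: "'a :: idom"
  assumes "(Q - 1) * h\<^sup>2 = 1 - 2 * h"
  shows "(N * (1 + (Q - 1) * h) + h)\<^sup>2 = Q * N\<^sup>2 + 2 * (1 - h) * N + h\<^sup>2"
  using assms by Groebner_Basis.algebra

lemma hyp_coefficient_identity:
  fixes Q K N M h a b :: "'a :: idom"
  assumes "N = 1 + Q * K" "M = 1 + Q * N"
  shows "Q * (N * (M * b)) - Q\<^sup>2 * (K * (N * a)) + M * b - (2 + Q - 2 * h) * (N * a) - h\<^sup>2 * a
      = M\<^sup>2 * b - (Q * N\<^sup>2 + 2 * (1 - h) * N + h\<^sup>2) * a"
  using assms by Groebner_Basis.algebra

lemma partial_sum_identity: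
  fixes N b C a t s Q :: "'a :: idom"
  assumes "N\<^sup>2 * b = C * a" "N * t = N * s + (2 + (Q - 1) * N)"
  shows "N\<^sup>2 * (b * t) - C * (a * s) = N * b + (1 + (Q - 1) * N) * (N * b)"
  using assms by Groebner_Basis.algebra

lemma first_order_identity:
  fixes M N Q a b h :: "'a :: idom"
  assumes "M\<^sup>2 * b = (Q * N\<^sup>2 + 2 * (1 - h) * N + h\<^sup>2) * a"
    "(Q - 1) * h\<^sup>2 = 1 - 2 * h" "M = 1 + Q * N"
  shows "M * b - N * a = Q * (1 + (Q - 1) * N) * (M * b) - Q * (1 + (Q - 1) * N) * (N * a)
      + (2 * h - 1) * ((1 + (Q - 1) * N) * a)"
  using assms by Groebner_Basis.algebra

lemma derivative_of_log_derivative_identity: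
  fixes Q x d g u :: "'a :: idom"
  assumes "Q * x * (1 - Q * x) * g = 1" "g = u + (Q - 1) * x * d" "x * (1 - x) * u = 1"
  shows "(Q - 1) * x * (Q * x * (1 - Q * x) * d) = (Q - 1) * x * (- (1 - (1 + Q) * x) * u)"
  using assms by Groebner_Basis.algebra

lemma cross_term_identity:
  fixes Q x d g u A B h :: "'a :: idom"
  assumes "Q * x * (1 - Q * x) * g = 1" "Q * x * (1 - Q * x) * d = - (1 - (1 + Q) * x) * u"
    "x * (1 - x) * u = 1"
  shows "(1 - x) * (Q * x * (1 - Q * x) * (A * u + (Q * A * g + B * d)) + (1 - (2 + Q - 2 * h) * x) * (B * u))
      = Q * (2 - (1 + Q) * x) * A + (2 * h - 1) * B"
  using assms by Groebner_Basis.algebra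

lemma log_derivative_identity:
  fixes x y d :: "'a :: idom"
  assumes "(1 - x) * d = -1" "x * y = 1"
  shows "x * (1 - x) * (y - d) = 1"
  using assms by Groebner_Basis.algebra

section \<open>Algebra of $q$-numbers\<close>

declare qvar_neq_0 [simp] qvar_neq_1 [simp]

lemma to_qfrac_mult: "to_qfrac (x * y) = to_qfrac x * (to_qfrac y :: 'p::prime_card qfrac)"
  by simp

lemma to_qfrac_power: "to_qfrac (x ^ n) = (to_qfrac x ^ n :: 'p::prime_card qfrac)"
proof (induction n)
  case (Suc n)
  show ?case by (simp only: power_Suc to_qfrac_mult Suc)
qed (simp add: Fraction_Field.One_fract_def)

lemma to_qfrac_q_pow_of_nat: "to_qfrac (q_pow (of_nat n)) = (qvar ^ n :: 'p::prime_card qfrac)"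
  by (simp add: q_pow_of_nat to_qfrac_power qvar_def)

lemma q_num_of_nat: "q_num (of_nat n) = ((qvar ^ n - 1) / (qvar - 1) :: 'p::prime_card qfrac)"
  by (simp add: q_num_def to_qfrac_q_pow_of_nat)

lemma qvar_power_neq_1:
  assumes "n > 0"
  shows "qvar ^ n \<noteq> (1 :: 'p::prime_card qfrac)"
proof
  assume "qvar ^ n = (1 :: 'p qfrac)"
  hence "to_qfrac (q_pow (of_nat n)) = (to_qfrac 1 :: 'p qfrac)"
    by (simp add: to_qfrac_q_pow_of_nat Fraction_Field.One_fract_def)
  hence "q_pow (of_nat n) $ 1 = (1 :: 'p qring) $ 1" by (simp add: eq_fract)
  hence "(of_int (int n) :: 'p padic_int) = 0"
    using padic_of_rat_of_int[of "int n", where 'p = 'p] by (simp add: q_pow_def)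
  thus False using assms by (simp only: of_int_padic_eq_0_iff)
qed

lemma q_num_of_nat_neq_0: "n > 0 \<Longrightarrow> q_num (of_nat n) \<noteq> (0 :: 'p::prime_card qfrac)"
  by (simp add: q_num_of_nat qvar_power_neq_1)

text \<open>
  The square of $q^{1/2} = 1 + (q-1)[\frac12]_q$ is $q$; expand and divide by $q-1$.
\<close>

lemma q_num_half_quadratic:
  assumes "odd CARD('p::prime_card)"
  shows "(qvar - 1) * (q_num (1/2))\<^sup>2 = (1 - 2 * q_num (1/2) :: 'p qfrac)"
proof -
  define s where "s = (to_qfrac (q_pow (1/2)) :: 'p qfrac)"
  have "s ^ 2 = to_qfrac (q_pow (of_nat 1))"
    using q_pow_add[of "1/2" "1/2", where 'p = 'p] p_integral_half[of "CARD('p)"] prime_card[where 'a = 'p] assms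
    by (simp add: s_def power2_eq_square)
  hence s2: "s ^ 2 = qvar" unfolding to_qfrac_q_pow_of_nat by simp
  have "(qvar - 1) * q_num (1/2) = s - 1"
    by (simp add: q_num_def s_def)
  hence "s = 1 + (qvar - 1) * q_num (1/2)" by simp
  hence "(1 + (qvar - 1) * q_num (1/2))\<^sup>2 = (qvar :: 'p qfrac)" using s2 by simp
  hence "(qvar - 1) * ((qvar - 1) * (q_num (1/2))\<^sup>2) = (qvar - 1) * (1 - 2 * q_num (1/2) :: 'p qfrac)"
    by (rule half_quadratic_identity)
  thus ?thesis by simp
qed

text \<open>
  From $q^{n+1/2} = q^n q^{1/2}$ one gets $[n+\frac12]_q = q^{1/2}[n]_q + [\frac12]_q$. Squaring and
  using the quadratic relation for $[\frac12]_q$ turns the result into a polynomial in $[n]_q$ whose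
  coefficients, those of the operator $L$, are free of $q^{1/2}$.
\<close>

lemma q_num_add_half_square:
  assumes "odd CARD('p::prime_card)"
  defines "N \<equiv> \<lambda>n. q_num (of_nat n) :: 'p qfrac"
  shows "(q_num (of_nat n + 1/2))\<^sup>2 =
           qvar * (N n)\<^sup>2 + 2 * (1 - q_num (1/2)) * N n + (q_num (1/2))\<^sup>2"
proof -
  define h where "h = (q_num (1/2) :: 'p qfrac)"
  define s where "s = (to_qfrac (q_pow (1/2)) :: 'p qfrac)"
  have nz: "qvar - 1 \<noteq> (0 :: 'p qfrac)" by simp
  have "q_pow (of_nat n + 1/2) = (q_pow (of_nat n) * q_pow (1/2) :: 'p qring)"
    using p_integral_of_int[of "CARD('p)" "int n"] p_integral_half[of "CARD('p)"] prime_card[where 'a = 'p] assms(1)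
    by (intro q_pow_add) auto
  hence "to_qfrac (q_pow (of_nat n + 1/2)) = (qvar ^ n * s :: 'p qfrac)"
    by (simp only: to_qfrac_mult to_qfrac_q_pow_of_nat s_def)
  hence "(qvar - 1) * q_num (of_nat n + 1/2) = (qvar ^ n * s - 1 :: 'p qfrac)"
    using nz by (simp add: q_num_def)
  moreover have "(qvar - 1) * h = s - 1" using nz by (simp add: q_num_def h_def s_def)
  moreover have "(qvar - 1) * N n = qvar ^ n - 1" using nz by (simp add: q_num_of_nat N_def)
  moreover have "(qvar - 1) * (N n * (1 + (qvar - 1) * h) + h)
      = ((qvar - 1) * N n) * (1 + (qvar - 1) * h) + (qvar - 1) * h"
    by (simp only: distrib_left mult.assoc)
  moreover have "(qvar ^ n - 1) * (1 + (s - 1)) + (s - 1) = qvar ^ n * s - 1"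
    by (simp add: algebra_simps)
  ultimately have "(qvar - 1) * q_num (of_nat n + 1/2)
      = (qvar - 1) * (N n * (1 + (qvar - 1) * h) + h)"
    by (simp only:)
  hence "q_num (of_nat n + 1/2) = N n * (1 + (qvar - 1) * h) + h" using nz by simp
  moreover have "(qvar - 1) * h\<^sup>2 = 1 - 2 * h"
    unfolding h_def using q_num_half_quadratic[OF assms(1)] .
  ultimately show ?thesis
    unfolding h_def[symmetric] by (simp only: half_shift_identity)
qed


section \<open>The $q$-derivative on Laurent series\<close>

lemma gamma_fls_nth: "gamma_fls f $$ n = f $$ n * qvar powi n"
  by (simp add: gamma_fls.rep_eq)

lemma gamma_fls_0 [simp]: "gamma_fls 0 = (0 :: 'p::prime_card qfrac fls)"
  by (rule fls_eqI) (simp add: gamma_fls_nth)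

lemma gamma_fls_const [simp]: "gamma_fls (fls_const c) = (fls_const c :: 'p::prime_card qfrac fls)"
  by (rule fls_eqI) (simp add: gamma_fls_nth)

lemma gamma_fls_1 [simp]: "gamma_fls 1 = (1 :: 'p::prime_card qfrac fls)"
  using gamma_fls_const[of "1 :: 'p qfrac"] by simp

lemma gamma_fls_X [simp]: "gamma_fls fls_X = (fls_const qvar * fls_X :: 'p::prime_card qfrac fls)"
  by (rule fls_eqI) (simp add: gamma_fls_nth)

lemma gamma_fls_add: "gamma_fls (f + g) = gamma_fls f + (gamma_fls g :: 'p::prime_card qfrac fls)"
  by (rule fls_eqI) (simp add: gamma_fls_nth algebra_simps)

lemma gamma_fls_diff: "gamma_fls (f - g) = gamma_fls f - (gamma_fls g :: 'p::prime_card qfrac fls)"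
  by (rule fls_eqI) (simp add: gamma_fls_nth algebra_simps)

lemma fls_subdegree_gamma_fls [simp]:
  "fls_subdegree (gamma_fls f) = fls_subdegree (f :: 'p::prime_card qfrac fls)"
proof (cases "f = 0")
  case False
  thus ?thesis by (intro fls_subdegree_eqI) (auto simp: gamma_fls_nth qvar_neq_0)
qed simp

text \<open>
  The automorphism is the substitution $\lambda \mapsto q\lambda$: each term of the Cauchy product at
  degree $n$ is scaled by $q^i q^{n-i} = q^n$.
\<close>

lemma gamma_fls_mult: "gamma_fls (f * g) = gamma_fls f * (gamma_fls g :: 'p::prime_card qfrac fls)"
proof (rule fls_eqI)
  fix n
  have powi: "qvar powi i * qvar powi (n - i) = (qvar powi n :: 'p qfrac)" for i
    by (simp add: power_int_add[symmetric])
  have eq: "f $$ i * qvar powi i * (g $$ (n - i) * qvar powi (n - i)) = f $$ i * g $$ (n - i) * qvar powi n" for i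
    unfolding powi[of i, symmetric] by (simp only: ac_simps)
  have "(gamma_fls f * gamma_fls g) $$ n = (\<Sum>i = fls_subdegree f..n - fls_subdegree g.
      f $$ i * qvar powi i * (g $$ (n - i) * qvar powi (n - i)))"
    by (simp add: gamma_fls_nth fls_times_nth(2))
  also have "\<dots> = gamma_fls (f * g) $$ n"
    by (simp only: eq gamma_fls_nth fls_times_nth(2) sum_distrib_right)
  finally show "gamma_fls (f * g) $$ n = (gamma_fls f * gamma_fls g) $$ n" ..
qed

definition dq_fls :: "'p::prime_card qfrac fls \<Rightarrow> 'p qfrac fls" where
  "dq_fls f = inverse (fls_const (qvar - 1) * fls_X) * (gamma_fls f - f)"

lemma fls_const_qvar_minus_1: "fls_const (qvar - 1) = fls_const qvar - (1 :: 'p::prime_card qfrac fls)"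
  by (metis fls_const_1 fls_minus_const)

lemma fls_const_qvar_neq_1: "fls_const qvar - 1 \<noteq> (0 :: 'p::prime_card qfrac fls)"
  by (simp add: fls_const_nonzero qvar_neq_1 flip: fls_const_qvar_minus_1)

lemma dq_fls_iff:
  "dq_fls f = g \<longleftrightarrow> gamma_fls f - f = (fls_const qvar - 1) * fls_X * (g :: 'p::prime_card qfrac fls)"
proof -
  have nz: "(fls_const qvar - 1) * fls_X \<noteq> (0 :: 'p qfrac fls)"
    using fls_const_qvar_neq_1 by simp
  show ?thesis
    unfolding dq_fls_def fls_const_qvar_minus_1
    by (metis (no_types) nz left_inverse right_inverse mult.assoc mult_1_left)
qed

lemma gamma_fls_conv_dq: "gamma_fls f = f + (fls_const qvar - 1) * fls_X * (dq_fls f :: 'p::prime_card qfrac fls)"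
  using dq_fls_iff[of f "dq_fls f"] by (simp add: algebra_simps)

lemma dq_fls_add: "dq_fls (f + g) = dq_fls f + (dq_fls g :: 'p::prime_card qfrac fls)"
  by (simp add: dq_fls_def gamma_fls_add algebra_simps)

lemma dq_fls_diff: "dq_fls (f - g) = dq_fls f - (dq_fls g :: 'p::prime_card qfrac fls)"
  by (simp add: dq_fls_def gamma_fls_diff algebra_simps)

lemma dq_fls_mult: "dq_fls (f * g) = dq_fls f * g + gamma_fls f * (dq_fls g :: 'p::prime_card qfrac fls)"
  by (simp add: dq_fls_def gamma_fls_mult algebra_simps)

lemma dq_gamma_fls: "dq_fls (gamma_fls f) = fls_const qvar * gamma_fls (dq_fls f :: 'p::prime_card qfrac fls)"
  unfolding dq_fls_iff
  using arg_cong[OF gamma_fls_conv_dq[of f], of gamma_fls]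
  by (simp add: gamma_fls_add gamma_fls_mult gamma_fls_diff algebra_simps)

text \<open>
  The $q$-numbers of arbitrary integers, as they occur when Laurent series are differentiated.
\<close>

definition q_bracket :: "int \<Rightarrow> 'p::prime_card qfrac" where
  "q_bracket n = (qvar powi n - 1) / (qvar - 1)"

lemma q_bracket_of_nat: "q_bracket (int n) = (q_num (of_nat n) :: 'p::prime_card qfrac)"
  by (simp add: q_bracket_def q_num_of_nat)

lemma q_bracket_0 [simp]: "q_bracket 0 = (0 :: 'p::prime_card qfrac)"
  by (simp add: q_bracket_def)

lemma qvar_powi: "qvar powi n = 1 + (qvar - 1) * (q_bracket n :: 'p::prime_card qfrac)"
  by (simp add: q_bracket_def)

lemma q_bracket_add_1: "q_bracket (n + 1) = 1 + qvar * (q_bracket n :: 'p::prime_card qfrac)"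
proof -
  have nz: "qvar - 1 \<noteq> (0 :: 'p qfrac)" by simp
  have "1 + (qvar - 1) * q_bracket (n + 1) = qvar * (1 + (qvar - 1) * (q_bracket n :: 'p qfrac))"
    by (simp add: power_int_add qvar_neq_0 flip: qvar_powi)
  hence "(qvar - 1) * q_bracket (n + 1) = (qvar - 1) * (1 + qvar * (q_bracket n :: 'p qfrac))"
    by (simp add: algebra_simps)
  thus ?thesis using nz by simp
qed

lemma fls_X_mult_nth [simp]: "(fls_X * f) $$ n = (f $$ (n - 1) :: 'a :: comm_ring_1)"
  by (simp add: fls_X_times_conv_shift)

lemma dq_fls_nth: "dq_fls f $$ n = q_bracket (n + 1) * (f $$ (n + 1) :: 'p::prime_card qfrac)"
proof -
  define g where "g = dq_fls f"
  have "(gamma_fls f - f) $$ (n + 1) = (fls_const (qvar - 1) * (fls_X * g)) $$ (n + 1)"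
    using gamma_fls_conv_dq[of f] by (simp add: g_def fls_const_qvar_minus_1 mult.assoc)
  hence "(qvar - 1) * (q_bracket (n + 1) * f $$ (n + 1)) = (qvar - 1) * g $$ n"
    by (simp add: gamma_fls_nth qvar_powi algebra_simps)
  thus ?thesis by (simp add: g_def)
qed

section \<open>The hypergeometric operator\<close>

definition hyp_L_fls :: "'p::prime_card qfrac fls \<Rightarrow> 'p qfrac fls" where
  "hyp_L_fls f =
     fls_const qvar * fls_X * (1 - fls_const qvar * fls_X) * dq_fls (dq_fls f)
     + (1 - fls_const (1 + q_num 2 - 2 * q_num (1 / 2)) * fls_X) * dq_fls f
     - fls_const ((q_num (1 / 2))\<^sup>2) * f"

text \<open>
  The part of $L[fg]$ in which $g$ is differentiated, as a function of $f$ and $v = d_q g$. It is kept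
  as a function of $v$ because $g$ may be $\log_q\lambda$, whose derivative is a Laurent series although
  $g$ is not.
\<close>

definition hyp_cross_term :: "'p::prime_card qfrac fls \<Rightarrow> 'p qfrac fls \<Rightarrow> 'p qfrac fls" where
  "hyp_cross_term f v =
     fls_const qvar * fls_X * (1 - fls_const qvar * fls_X) * (gamma_fls (dq_fls f) * v + dq_fls (gamma_fls f * v))
     + (1 - fls_const (1 + q_num 2 - 2 * q_num (1 / 2)) * fls_X) * (gamma_fls f * v)"

lemma hyp_cross_term_diff: "hyp_cross_term f (v - w) = hyp_cross_term f v - (hyp_cross_term f w :: 'p::prime_card qfrac fls)"
  by (simp add: hyp_cross_term_def right_diff_distrib dq_fls_diff) (simp add: algebra_simps)

lemma hyp_L_fls_diff: "hyp_L_fls (f - g) = hyp_L_fls f - (hyp_L_fls g :: 'p::prime_card qfrac fls)"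
  by (simp add: hyp_L_fls_def dq_fls_diff) (simp add: algebra_simps)

lemma hyp_L_fls_mult: "hyp_L_fls (f * g) = hyp_L_fls f * g + hyp_cross_term f (dq_fls g :: 'p::prime_card qfrac fls)"
  by (simp add: hyp_L_fls_def hyp_cross_term_def dq_fls_mult dq_fls_add) (simp add: algebra_simps)

lemma d_q_linear:
  "d_q [: a, b :] = [: dq_fls a + gamma_fls b * inverse fls_X, dq_fls (b :: 'p::prime_card qfrac fls) :]"
proof -
  have nz: "fls_const (qvar - 1) \<noteq> (0 :: 'p qfrac fls)"
    by (simp add: fls_const_nonzero)
  have "gamma [: a, b :] = [: gamma_fls a + gamma_fls b * fls_const (qvar - 1), gamma_fls b :]"
    by (simp add: gamma_def Polynomial.map_poly_pCons pcompose_pCons algebra_simps)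
  moreover have "inverse (fls_const (qvar - 1) * fls_X) * (gamma_fls b * fls_const (qvar - 1))
                   = gamma_fls b * inverse (fls_X :: 'p qfrac fls)"
    using nz by (simp only: inverse_mult_distrib ac_simps) (simp only: right_inverse[OF nz] mult_1_right)
  ultimately show ?thesis
    by (simp add: d_q_def dq_fls_def distrib_left right_diff_distrib algebra_simps)
qed

text \<open>
  Action of the operator on $a + b\log_q\lambda$: the coefficient of $\log_q\lambda$ is acted on
  by $L$ alone, and $d_q\log_q\lambda = 1/\lambda$ feeds the cross term into the constant coefficient.
\<close>

lemma hyp_L_linear:
  "hyp_L [: a, b :] =
     [: hyp_L_fls a + hyp_cross_term b (inverse fls_X), hyp_L_fls (b :: 'p::prime_card qfrac fls) :]"
  by (simp add: hyp_L_def hyp_L_fls_def hyp_cross_term_def d_q_linear dq_fls_add) (simp add: algebra_simps)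

lemma q_num_2: "q_num 2 = (1 + qvar :: 'p::prime_card qfrac)"
proof -
  have "q_num (of_nat 2) = (1 + qvar :: 'p qfrac)"
    unfolding q_num_of_nat by (simp add: field_simps power2_eq_square)
  thus ?thesis by simp
qed

text \<open>
  The shape of the $q$-hypergeometric recurrence: by $[n+1]_q = 1 + q[n]_q$ the contributions of
  $q\lambda d_q^2$ and $d_q$ combine to a square, and the remaining ones to the polynomial in $[n]_q$
  that represents $[n+\frac12]_q^2$.
\<close>

lemma hyp_L_fls_nth:
  "hyp_L_fls f $$ n = (q_bracket (n + 1))\<^sup>2 * f $$ (n + 1)
     - (qvar * (q_bracket n)\<^sup>2 + 2 * (1 - q_num (1/2)) * q_bracket n + (q_num (1/2))\<^sup>2)
         * (f $$ n :: 'p::prime_card qfrac)"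
proof -
  have b0: "q_bracket n = 1 + qvar * (q_bracket (n - 1) :: 'p qfrac)"
    using q_bracket_add_1[of "n - 1"] by simp
  have "hyp_L_fls f = fls_const qvar * (fls_X * dq_fls (dq_fls f))
      - fls_const (qvar ^ 2) * (fls_X * (fls_X * dq_fls (dq_fls f)))
      + dq_fls f - fls_const (2 + qvar - 2 * q_num (1/2)) * (fls_X * dq_fls f)
      - fls_const ((q_num (1 / 2))\<^sup>2) * f"
    unfolding hyp_L_fls_def q_num_2
    by (simp add: algebra_simps power2_eq_square flip: fls_const_mult_const)
  hence "hyp_L_fls f $$ n = qvar * (q_bracket n * (q_bracket (n + 1) * f $$ (n + 1)))
      - qvar ^ 2 * (q_bracket (n - 1) * (q_bracket n * f $$ n))
      + q_bracket (n + 1) * f $$ (n + 1)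
      - (2 + qvar - 2 * q_num (1/2)) * (q_bracket n * f $$ n) - (q_num (1/2))\<^sup>2 * f $$ n"
    by (simp add: dq_fls_nth)
  thus ?thesis
    by (simp only: hyp_coefficient_identity[OF b0 q_bracket_add_1])
qed

section \<open>The two solutions\<close>

lemma F_series_nth: "F_series $$ n = (if n < 0 then 0 else hyp_coeff (nat n))"
  by (simp add: F_series_def)

lemma hyp_coeff_rec:
  assumes "odd CARD('p::prime_card)"
  shows "(q_bracket (int n + 1))\<^sup>2 * hyp_coeff (Suc n) =
     (qvar * (q_bracket (int n))\<^sup>2 + 2 * (1 - q_num (1/2)) * q_bracket (int n) + (q_num (1/2))\<^sup>2)
       * (hyp_coeff n :: 'p qfrac)"
proof -
  have "q_bracket (int n + 1) = (q_num (of_nat n + 1) :: 'p qfrac)"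
    using q_bracket_of_nat[of "Suc n"] by (simp add: add.commute)
  moreover have "q_num (of_nat n + 1) \<noteq> (0 :: 'p qfrac)"
    using q_num_of_nat_neq_0[of "Suc n"] by (simp add: add.commute)
  ultimately show ?thesis
    using q_num_add_half_square[OF assms, of n]
    by (simp add: hyp_coeff_def q_bracket_of_nat power_divide)
qed

text \<open>
  For a power series $f$ the coefficient of $L[f]$ at $\lambda^n$ involves $f$ in degrees $n$ and $n+1$,
  so $n = -1$ is the one negative degree that is not trivial; there the factor $[0]_q = 0$ intervenes.
\<close>

lemma int_minus_1_cases:
  obtains "n < -1" | "n = -1" | m where "n = int m"
proof (cases "n \<ge> 0")
  case True
  thus ?thesis using that(3) zero_le_imp_eq_int by blast
next
  case False
  thus ?thesis using that(1,2) by linarith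
qed

lemma hyp_L_fls_F_series:
  assumes "odd CARD('p::prime_card)"
  shows "hyp_L_fls F_series = (0 :: 'p qfrac fls)"
proof (rule fls_eqI)
  fix n :: int
  show "hyp_L_fls F_series $$ n = (0 :: 'p qfrac fls) $$ n"
  proof (cases n rule: int_minus_1_cases)
    case (3 m)
    thus ?thesis using hyp_coeff_rec[OF assms, of m]
      by (simp add: hyp_L_fls_nth F_series_nth nat_add_distrib)
  qed (simp_all add: hyp_L_fls_nth F_series_nth)
qed

lemma dq_log_one_minus_lambda:
  "(1 - fls_X) * dq_fls log_one_minus_lambda = (-1 :: 'p::prime_card qfrac fls)"
proof -
  have nth: "dq_fls log_one_minus_lambda $$ n = (if n < 0 then 0 else -1 :: 'p qfrac)" for n
  proof (cases "n < 0")
    case False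
    then obtain m where "n = int m" using zero_le_imp_eq_int[of n] by auto
    moreover have "q_bracket (int m + 1) = (q_num (of_nat (Suc m)) :: 'p qfrac)"
      using q_bracket_of_nat[of "Suc m"] by (simp add: add.commute)
    moreover have "q_num (of_nat (Suc m)) \<noteq> (0 :: 'p qfrac)"
      by (rule q_num_of_nat_neq_0) simp
    ultimately show ?thesis
      by (simp add: dq_fls_nth log_one_minus_lambda_def nat_add_distrib)
  qed (auto simp: dq_fls_nth log_one_minus_lambda_def)
  show ?thesis
    by (rule fls_eqI) (auto simp: left_diff_distrib nth)
qed

definition harmonic_correction :: "'p::prime_card qfrac fls" where
  "harmonic_correction = fps_to_fls (Abs_fps (\<lambda>n. if n = 0 then 0 else
            hyp_coeff n * (\<Sum>i=1..n. (2 / q_num (of_nat i) + qvar - 1))))"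

text \<open>
  Because $a_n$ satisfies the recurrence, only the increment $2/[n+1]_q + q - 1$ of the partial sums
  survives. Multiplied by $[n+1]_q^2$ it becomes $[n+1]_q(1 + q^{n+1})$, where the two summands
  are the effects of $d_q$ and of $q\gamma d_q$.
\<close>

lemma hyp_L_fls_harmonic_correction:
  assumes "odd CARD('p::prime_card)"
  shows "hyp_L_fls harmonic_correction = dq_fls F_series + fls_const qvar * gamma_fls (dq_fls F_series :: 'p qfrac fls)"
proof (rule fls_eqI)
  fix n :: int
  show "hyp_L_fls harmonic_correction $$ n =
     (dq_fls F_series + fls_const qvar * gamma_fls (dq_fls F_series :: 'p qfrac fls)) $$ n"
  proof (cases n rule: int_minus_1_cases)
    case (3 m)
    define S where "S = (\<lambda>n. \<Sum>i=1..n. (2 / q_num (of_nat i) + qvar - 1 :: 'p qfrac))"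
    define N where "N = (q_bracket (int m + 1) :: 'p qfrac)"
    have G: "harmonic_correction $$ int k = hyp_coeff k * S k" for k
      by (simp add: harmonic_correction_def S_def)
    have N: "q_num (of_nat (Suc m)) = N"
      using q_bracket_of_nat[of "Suc m", where 'p = 'p] by (simp add: N_def add.commute)
    have N0: "N \<noteq> 0" unfolding N[symmetric] by (rule q_num_of_nat_neq_0) simp
    have "S (Suc m) = S m + (2 / q_num (of_nat (Suc m)) + qvar - 1)"
      by (simp add: S_def)
    hence "N * S (Suc m) = N * (S m + (2 / N + qvar - 1))" unfolding N by (rule arg_cong)
    also have "\<dots> = N * S m + (2 + (qvar - 1) * N)"
      using N0 by (simp add: algebra_simps)
    finally have S: "N * S (Suc m) = N * S m + (2 + (qvar - 1) * N)" .
    have "qvar * qvar powi (int m) = (qvar powi (int m + 1) :: 'p qfrac)"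
      by (simp add: power_int_add qvar_neq_0)
    also have "\<dots> = 1 + (qvar - 1) * N" by (simp add: N_def qvar_powi)
    finally have q: "qvar * qvar powi (int m) = 1 + (qvar - 1) * N" .
    define C where "C = (qvar * (q_bracket (int m))\<^sup>2 + 2 * (1 - q_num (1/2)) * q_bracket (int m) + (q_num (1/2))\<^sup>2 :: 'p qfrac)"
    have rec: "N ^ 2 * hyp_coeff (Suc m) = C * hyp_coeff m"
      unfolding C_def N_def by (rule hyp_coeff_rec[OF assms])
    have "hyp_L_fls harmonic_correction $$ n = N ^ 2 * (hyp_coeff (Suc m) * S (Suc m)) - C * (hyp_coeff m * S m)"
      using G[of m] G[of "Suc m"] by (simp add: 3 hyp_L_fls_nth C_def N_def add.commute)
    also have "\<dots> = N * hyp_coeff (Suc m) + (1 + (qvar - 1) * N) * (N * hyp_coeff (Suc m))"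
      by (rule partial_sum_identity[OF rec S])
    also have "\<dots> = N * hyp_coeff (Suc m) + qvar * qvar powi (int m) * (N * hyp_coeff (Suc m))"
      by (simp only: q)
    also have "\<dots> = (dq_fls F_series + fls_const qvar * gamma_fls (dq_fls F_series :: 'p qfrac fls)) $$ n"
      by (simp add: 3 dq_fls_nth gamma_fls_nth F_series_nth nat_add_distrib N_def)
    finally show ?thesis .
  qed (simp_all add: hyp_L_fls_nth harmonic_correction_def dq_fls_nth gamma_fls_nth F_series_nth)
qed

text \<open>
  Here $u = 1/(\lambda(1-\lambda))$, so that $\gamma u = 1/(q\lambda(1-q\lambda))$ is the inverse of
  the leading coefficient of $L$. This makes $\gamma u$ and $d_q u$ cancel against that
  coefficient and leaves $1-\lambda$ as the one denominator.
\<close>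

lemma hyp_cross_term_explicit:
  fixes f u :: "'p::prime_card qfrac fls"
  assumes u: "fls_X * (1 - fls_X) * u = 1"
  shows "(1 - fls_X) * hyp_cross_term f u =
     fls_const qvar * (2 - (1 + fls_const qvar) * fls_X) * gamma_fls (dq_fls f)
       + (2 * fls_const (q_num (1/2)) - 1) * gamma_fls f"
proof -
  define x where "x = (fls_X :: 'p qfrac fls)"
  define Q where "Q = (fls_const qvar :: 'p qfrac fls)"
  define h where "h = (fls_const (q_num (1/2)) :: 'p qfrac fls)"
  have gu: "Q * x * (1 - Q * x) * gamma_fls u = 1"
    using arg_cong[OF u, of gamma_fls] by (simp add: gamma_fls_mult gamma_fls_diff Q_def x_def)
  have u': "x * (1 - x) * u = 1" using u by (simp add: x_def)
  have Q1: "Q - 1 \<noteq> 0" and x0: "x \<noteq> 0" unfolding Q_def x_def using fls_const_qvar_neq_1 by auto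
  have gu_u: "gamma_fls u = u + (Q - 1) * x * dq_fls u"
    using gamma_fls_conv_dq[of u] by (simp add: Q_def x_def)
  have "(Q - 1) * x * (Q * x * (1 - Q * x) * dq_fls u) = (Q - 1) * x * (- (1 - (1 + Q) * x) * u)"
    by (rule derivative_of_log_derivative_identity[OF gu gu_u u'])
  hence du: "Q * x * (1 - Q * x) * dq_fls u = - (1 - (1 + Q) * x) * u"
    using Q1 x0 by simp
  have dgu: "dq_fls (gamma_fls f * u) = dq_fls (gamma_fls f) * gamma_fls u + gamma_fls f * dq_fls u"
  proof -
    have "dq_fls (u * gamma_fls f) = dq_fls u * gamma_fls f + gamma_fls u * dq_fls (gamma_fls f)"
      by (rule dq_fls_mult)
    thus ?thesis by (simp add: algebra_simps)
  qed
  have c: "fls_const (1 + q_num 2 - 2 * q_num (1 / 2)) = 2 + Q - 2 * h"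
    by (simp add: q_num_2 Q_def h_def flip: fls_plus_const fls_minus_const fls_const_mult_const)
  have T: "hyp_cross_term f u = Q * x * (1 - Q * x) * (gamma_fls (dq_fls f) * u +
           (Q * gamma_fls (dq_fls f) * gamma_fls u + gamma_fls f * dq_fls u))
           + (1 - (2 + Q - 2 * h) * x) * (gamma_fls f * u)"
    unfolding hyp_cross_term_def dgu dq_gamma_fls c by (simp add: Q_def x_def)
  have "(1 - x) * hyp_cross_term f u =
     Q * (2 - (1 + Q) * x) * gamma_fls (dq_fls f) + (2 * h - 1) * gamma_fls f"
    unfolding T by (rule cross_term_identity[OF gu du u'])
  thus ?thesis by (simp add: x_def Q_def h_def)
qed

text \<open>
  At degree $n$ this relation is $1-q$ times the recurrence for $a_n$, since
  $[n+1]_q(1-q^{n+1}) = (1-q)[n+1]_q^2$. The quadratic relation for $[\frac12]_q$ supplies the constant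
  $2[\frac12]_q - 1$, which is $(1-q)[\frac12]_q^2$.
\<close>

lemma F_series_first_order:
  assumes "odd CARD('p::prime_card)"
  shows "(1 - fls_X) * dq_fls F_series =
     fls_const qvar * (1 - fls_const qvar * fls_X) * gamma_fls (dq_fls F_series)
       + (2 * fls_const (q_num (1/2)) - 1) * (gamma_fls F_series :: 'p qfrac fls)"
    (is "?l = ?r")
proof (rule fls_eqI)
  fix n :: int
  define N where "N = (q_bracket n :: 'p qfrac)"
  define M where "M = (q_bracket (n + 1) :: 'p qfrac)"
  define h where "h = (q_num (1/2) :: 'p qfrac)"
  define a where "a = (F_series $$ n :: 'p qfrac)"
  define b where "b = (F_series $$ (n + 1) :: 'p qfrac)"
  have M: "M = 1 + qvar * N" by (simp add: M_def N_def q_bracket_add_1)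
  have qn: "qvar powi n = 1 + (qvar - 1) * N" by (simp add: N_def qvar_powi)
  have qn1: "qvar powi (n - 1) * qvar = 1 + (qvar - 1) * N"
    unfolding qn[symmetric] by (simp add: power_int_diff qvar_neq_0)
  have half: "(qvar - 1) * h\<^sup>2 = 1 - 2 * h"
    unfolding h_def by (rule q_num_half_quadratic[OF assms])
  have "hyp_L_fls F_series $$ n = (0 :: 'p qfrac)"
    using hyp_L_fls_F_series[OF assms] by simp
  hence rec: "M\<^sup>2 * b = (qvar * N\<^sup>2 + 2 * (1 - h) * N + h\<^sup>2) * a"
    by (simp add: hyp_L_fls_nth N_def M_def h_def a_def b_def)
  have "?l = dq_fls F_series - fls_X * dq_fls F_series" by (simp add: algebra_simps)
  hence "?l $$ n = M * b - N * a"
    by (simp add: dq_fls_nth M_def N_def a_def b_def)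
  also have "\<dots> = qvar * (1 + (qvar - 1) * N) * (M * b) - qvar * (1 + (qvar - 1) * N) * (N * a)
      + (2 * h - 1) * ((1 + (qvar - 1) * N) * a)"
    by (rule first_order_identity[OF rec half M])
  also have "\<dots> = qvar * (M * b * qvar powi n) - qvar * (qvar powi (n - 1) * qvar) * (N * a)
      + (2 * h - 1) * (a * qvar powi n)"
    unfolding qn1 qn by (simp only: ac_simps)
  also have "?r = fls_const qvar * gamma_fls (dq_fls F_series)
      - fls_const (qvar * qvar) * (fls_X * gamma_fls (dq_fls F_series))
      + fls_const (2 * q_num (1/2) - 1) * gamma_fls F_series"
    by (simp add: algebra_simps flip: fls_plus_const fls_minus_const fls_const_mult_const)
  hence "qvar * (M * b * qvar powi n) - qvar * (qvar powi (n - 1) * qvar) * (N * a)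
      + (2 * h - 1) * (a * qvar powi n) = ?r $$ n"
    by (simp add: dq_fls_nth gamma_fls_nth M_def N_def a_def b_def h_def)
  finally show "?l $$ n = ?r $$ n" .
qed

theorem theorem5p1:
  assumes "odd CARD('p::prime_card)"
  shows "hyp_L (F_sol :: 'p qlog) = 0 \<and> hyp_L (H_sol :: 'p qlog) = 0"
proof -
  define F Log G where "F = (F_series :: 'p qfrac fls)" and "Log = (log_one_minus_lambda :: 'p qfrac fls)"
    and "G = (harmonic_correction :: 'p qfrac fls)"
  define u where "u = inverse fls_X - dq_fls Log"
  define Q where "Q = (fls_const qvar :: 'p qfrac fls)"
  define x where "x = (fls_X :: 'p qfrac fls)"
  have LF: "hyp_L_fls F = 0" unfolding F_def by (rule hyp_L_fls_F_series[OF assms])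
  have "(1 - x) * dq_fls Log = -1" unfolding Log_def x_def by (rule dq_log_one_minus_lambda)
  moreover have "x * inverse x = 1" by (simp add: x_def)
  ultimately have "x * (1 - x) * (inverse x - dq_fls Log) = 1"
    by (rule log_derivative_identity)
  hence u: "fls_X * (1 - fls_X) * u = 1" by (simp add: u_def x_def)
  have T: "(1 - x) * hyp_cross_term F u = Q * (2 - (1 + Q) * x) * gamma_fls (dq_fls F)
       + (2 * fls_const (q_num (1/2)) - 1) * gamma_fls F"
    unfolding x_def Q_def by (rule hyp_cross_term_explicit[OF u])
  have first: "(1 - x) * dq_fls F = Q * (1 - Q * x) * gamma_fls (dq_fls F)
       + (2 * fls_const (q_num (1/2)) - 1) * gamma_fls F"
    unfolding x_def Q_def F_def by (rule F_series_first_order[OF assms])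
  have LG: "hyp_L_fls G = dq_fls F + Q * gamma_fls (dq_fls F)"
    unfolding G_def F_def Q_def by (rule hyp_L_fls_harmonic_correction[OF assms])
  \<comment> \<open>The multiple \<open>(1 - x) * dq_fls F\<close> coming from \<open>LG\<close> is eliminated by the first-order relation.\<close>
  have "(1 - x) * hyp_cross_term F u = (1 - x) * hyp_L_fls G"
    unfolding T LG using first by (simp add: algebra_simps)
  moreover have "1 - x \<noteq> 0" using u by (auto simp: x_def)
  ultimately have TG: "hyp_cross_term F u = hyp_L_fls G" by simp
  \<comment> \<open>The leading 0 writes the constant coefficient as a difference, the form in which
     linearity of \<open>L\<close> applies.\<close>
  have H_eq: "H_sol = [: 0 - F * Log - G, F :]"
    by (simp add: H_sol_def log_lambda_def F_def Log_def G_def harmonic_correction_def)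
  have cancel: "0 - a - b + c = 0" if "c - a = b" for a b c :: "'p qfrac fls"
    using that by auto
  have "hyp_L H_sol = [: hyp_L_fls (0 - F * Log - G) + hyp_cross_term F (inverse fls_X), hyp_L_fls F :]"
    unfolding H_eq by (rule hyp_L_linear)
  also have "hyp_L_fls (0 - F * Log - G) = hyp_L_fls 0 - hyp_cross_term F (dq_fls Log) - hyp_L_fls G"
    by (simp only: hyp_L_fls_diff hyp_L_fls_mult LF mult_zero_left add_0_left)
  also have "hyp_L_fls 0 = (0 :: 'p qfrac fls)" using hyp_L_fls_diff[of 0 0] by simp
  also have "0 - hyp_cross_term F (dq_fls Log) - hyp_L_fls G + hyp_cross_term F (inverse fls_X) = 0"
    using TG unfolding u_def hyp_cross_term_diff by (rule cancel)
  finally have H: "hyp_L (H_sol :: 'p qlog) = 0" by (simp add: LF)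
  have "hyp_L F_sol = hyp_L [: F, 0 :]" by (simp add: F_sol_def F_def)
  also have "\<dots> = 0" by (simp only: hyp_L_linear LF) (simp add: hyp_cross_term_def hyp_L_fls_def dq_fls_def)
  finally show ?thesis using H by blast
qed

end
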